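(* The function $p\mapsto b_p$ is concave on $(0,\infty)$. In particular, $$b_{\alpha p+(1-\alpha)q}>\alpha b_p+(1-\alpha)b_q>(b_p)^{\alpha}(b_q)^{1-\alpha}$$ for all $\alpha\in(0,1)$ and $p,q>0$ with $p\neq q$, and for all $s>1$ the following Turán type inequality holds: $$b_s^2>b_{s-1}b_{s+1}.$$
   Context: For $p>0$, $$b_p=\frac{1}{2p}\left(\psi\left(\frac{1+p}{2p}\right)-\psi\left(\frac{1}{2p}\right)\right)=\int_0^1(1+t^p)^{-1}\,dt,$$ where $\psi=\Gamma'/\Gamma$ is the digamma function (the two expressions are equal). *)

theory Defs
  imports "HOL-Analysis.Analysis"
begin

text \<open>
  For \<open>p > 0\<close> this equals the integral of \<open>1 / (1 + t powr p)\<close> over \<open>{0..1}\<close>.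
\<close>
definition b :: "real \<Rightarrow> real" where
  "b p = 1 / (2 * p) * (Digamma ((1 + p) / (2 * p)) - Digamma (1 / (2 * p)))"

end

theory Submission
  imports Defs "HOL-Real_Asymp.Real_Asymp"
begin

text \<open>
  For \<open>0 < t < 1\<close> the function \<open>p \<mapsto> 1 / (1 + t powr p)\<close> is the logistic function evaluated at
  \<open>p * ln (1 / t) > 0\<close>, where it is strictly increasing and strictly concave. Both properties pass
  to the integral over \<open>t\<close>. Monotonicity makes \<open>b p\<close> and \<open>b q\<close> distinct for \<open>p \<noteq> q\<close>, so that the
  weighted AM-GM inequality is strict, and the Turan inequality combines AM-GM with the case \<open>\<alpha> = 1/2\<close>.
\<close>

text \<open>The mean value theorem on both sides of the intermediate point turns the two slopes into
  derivative values, and the left one is larger.\<close>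

lemma strict_concave_deriv_less:
  fixes f f' :: "real \<Rightarrow> real"
  assumes a: "0 < a" "a < 1" and xy: "x < y"
    and deriv: "\<And>z. x \<le> z \<Longrightarrow> z \<le> y \<Longrightarrow> (f has_real_derivative f' z) (at z)"
    and dec: "\<And>u v. x < u \<Longrightarrow> u < v \<Longrightarrow> v < y \<Longrightarrow> f' v < f' u"
  shows "a * f x + (1 - a) * f y < f (a * x + (1 - a) * y)"
proof -
  define m where "m = a * x + (1 - a) * y"
  have mx: "m - x = (1 - a) * (y - x)" and ym: "y - m = a * (y - x)"
    by (simp_all add: m_def algebra_simps)
  have "m - x > 0" "y - m > 0"
    unfolding mx ym using a xy by simp_all
  hence m: "x < m" "m < y" by simp_all
  obtain u where u: "x < u" "u < m" "f m - f x = (m - x) * f' u"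
    using MVT2[of x m f f'] deriv m by (metis less_imp_le order_trans)
  obtain v where v: "m < v" "v < y" "f y - f m = (y - m) * f' v"
    using MVT2[of m y f f'] deriv m by (metis less_imp_le order_trans)
  have "f' v < f' u" using dec u v by auto
  \<comment> \<open>The common factor fits both sides, since \<open>a * (m - x)\<close> and
    \<open>(1 - a) * (y - m)\<close> both equal \<open>a * (1 - a) * (y - x)\<close>.\<close>
  hence "a * (1 - a) * (y - x) * f' v < a * (1 - a) * (y - x) * f' u"
    using a xy by (intro mult_strict_left_mono) auto
  hence "(1 - a) * (f y - f m) < a * (f m - f x)"
    unfolding u(3) v(3) mx ym by (simp add: mult_ac)
  thus ?thesis by (simp add: m_def algebra_simps)
qed

text \<open>Take logarithms: this is strict concavity of \<open>ln\<close>, whose derivative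
  \<open>1 / z\<close> is decreasing on the positive reals.\<close>

lemma weighted_am_gm_strict:
  fixes x y a :: real
  assumes a: "0 < a" "a < 1" and xy: "0 < x" "x < y"
  shows "x powr a * y powr (1 - a) < a * x + (1 - a) * y"
proof -
  have pos: "0 < a * x + (1 - a) * y" using a xy by (simp add: add_pos_pos)
  have "a * ln x + (1 - a) * ln y < ln (a * x + (1 - a) * y)"
    using a xy
    by (intro strict_concave_deriv_less[where f' = "\<lambda>z. 1 / z"])
       (auto intro!: derivative_eq_intros simp: divide_simps)
  moreover have "ln (x powr a * y powr (1 - a)) = a * ln x + (1 - a) * ln y"
    using xy by (simp add: ln_mult ln_powr)
  ultimately show ?thesis
    using pos xy by (metis ln_less_cancel_iff mult_pos_pos order_less_trans powr_gt_zero less_irrefl)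
qed

lemma integrand_strict_mono:
  fixes t p q :: real
  assumes "0 < t" "t < 1" "p < q"
  shows "1 / (1 + t powr p) < 1 / (1 + t powr q)"
proof -
  have "t powr q < t powr p" using assms by (intro powr_less_mono') auto
  moreover have "0 < t powr q" using assms by simp
  ultimately show ?thesis by (intro divide_strict_left_mono) (auto intro!: mult_pos_pos add_pos_pos)
qed

text \<open>With \<open>w = t powr z\<close>, the derivative in \<open>z\<close> is
  \<open>- ln t * (w / (1 + w)\<^sup>2)\<close>. Here \<open>- ln t\<close> is positive,
  \<open>w / (1 + w)\<^sup>2\<close> increases with \<open>w\<close> in (0,1), and \<open>w\<close>
  decreases in \<open>z\<close>.\<close>

lemma integrand_strict_concave:
  fixes t p q a :: real
  assumes t: "0 < t" "t < 1" and a: "0 < a" "a < 1" and pq: "0 < p" "p < q"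
  shows "a * (1 / (1 + t powr p)) + (1 - a) * (1 / (1 + t powr q))
         < 1 / (1 + t powr (a * p + (1 - a) * q))"
proof (rule strict_concave_deriv_less[where f' = "\<lambda>z. - ln t * (t powr z / (1 + t powr z)\<^sup>2)"])
  fix z
  have "0 < 1 + t powr z" using t by (simp add: add_pos_pos)
  thus "((\<lambda>z. 1 / (1 + t powr z)) has_real_derivative
          - ln t * (t powr z / (1 + t powr z)\<^sup>2)) (at z)"
    using t by (auto intro!: derivative_eq_intros simp: power2_eq_square)
next
  fix u v assume uv: "p < u" "u < v"
  define x y where "x = t powr v" and "y = t powr u"
  have xy: "0 < x" "x < y" "y < 1"
    using t uv pq powr_less_mono'[of t 0 u] by (auto simp: x_def y_def intro!: powr_less_mono')
  \<comment> \<open>The difference of the two fractions, cross-multiplied, splits into two factors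
    that are positive for \<open>0 < x < y < 1\<close>.\<close>
  have "y * (1 + x)\<^sup>2 - x * (1 + y)\<^sup>2 = (y - x) * (1 - x * y)"
    by (simp add: power2_eq_square algebra_simps)
  moreover have "x * y < 1" using xy mult_strict_mono[of x 1 y 1] by simp
  ultimately have "x * (1 + y)\<^sup>2 < y * (1 + x)\<^sup>2"
    using xy mult_pos_pos[of "y - x" "1 - x * y"] by linarith
  hence "x / (1 + x)\<^sup>2 < y / (1 + y)\<^sup>2"
    using xy by (simp add: divide_simps)
  thus "- ln t * (t powr v / (1 + t powr v)\<^sup>2) < - ln t * (t powr u / (1 + t powr u)\<^sup>2)"
    unfolding x_def y_def using t by (intro mult_strict_left_mono) auto
qed (use a pq in auto)

lemma continuous_on_integrand:
  fixes p :: real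
  assumes "0 < p"
  shows "continuous_on {0..1} (\<lambda>t::real. 1 / (1 + t powr p))"
proof -
  have "1 + t powr p \<noteq> 0" for t :: real
    using powr_ge_zero[of t p] by linarith
  thus ?thesis using assms
    by (intro continuous_intros continuous_on_powr') auto
qed

text \<open>Subtract the series of \<open>Digamma\<close> at the two arguments, which differ by 1/2;
  the Euler-Mascheroni constant cancels. The terms are the integrals over [0,1] of consecutive pairs
  in the geometric series of \<open>1 / (1 + t powr p)\<close>.\<close>

lemma b_sums:
  assumes p: "0 < p"
  shows "(\<lambda>n. 1 / (2 * real n * p + 1) - 1 / ((2 * real n + 1) * p + 1)) sums b p"
proof -
  define x y where "x = 1 / (2 * p)" and "y = (1 + p) / (2 * p)"
  have xy: "x > 0" "y > 0" using p by (simp_all add: x_def y_def)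
  have D: "(\<lambda>n. inverse (of_nat (Suc n)) - inverse (z + of_nat n)) sums
             (Digamma z + euler_mascheroni)" if "z > 0" for z :: real
    using summable_Digamma[of z] that by (simp add: Digamma_def summable_sums)
  have "(\<lambda>n. x * ((inverse (of_nat (Suc n)) - inverse (y + of_nat n))
                - (inverse (of_nat (Suc n)) - inverse (x + of_nat n)))) sums
        (x * ((Digamma y + euler_mascheroni) - (Digamma x + euler_mascheroni)))"
    using xy by (intro sums_mult sums_diff D)
  also have "x * ((Digamma y + euler_mascheroni) - (Digamma x + euler_mascheroni)) = b p"
    by (simp add: b_def x_def y_def)
  also have "(\<lambda>n. x * ((inverse (of_nat (Suc n)) - inverse (y + of_nat n))
                - (inverse (of_nat (Suc n)) - inverse (x + of_nat n))))
      = (\<lambda>n. 1 / (2 * real n * p + 1) - 1 / ((2 * real n + 1) * p + 1))"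
  proof
    fix n
    have "x + real n = (2 * real n * p + 1) * x" "y + real n = ((2 * real n + 1) * p + 1) * x"
      using p by (simp_all add: x_def y_def field_simps)
    hence "x * inverse (x + real n) = 1 / (2 * real n * p + 1)"
          "x * inverse (y + real n) = 1 / ((2 * real n + 1) * p + 1)"
      using xy by (simp_all add: inverse_eq_divide)
    thus "x * ((inverse (of_nat (Suc n)) - inverse (y + of_nat n))
                - (inverse (of_nat (Suc n)) - inverse (x + of_nat n)))
      = 1 / (2 * real n * p + 1) - 1 / ((2 * real n + 1) * p + 1)"
      by (simp add: right_diff_distrib)
  qed
  finally show ?thesis .
qed

text \<open>The geometric series is integrated up to a finite order with an explicit remainder, so
  no theorem on exchanging limit and integral is needed.\<close>

lemma b_eq_integral:
  assumes p: "0 < p"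
  shows "b p = integral {0..1} (\<lambda>t. 1 / (1 + t powr p))"
proof -
  define s where "s N = (\<Sum>n<N. 1 / (2 * real n * p + 1) - 1 / ((2 * real n + 1) * p + 1))" for N
  define I where "I = integral {0..1} (\<lambda>t. 1 / (1 + t powr p))"
  have int: "((\<lambda>t. 1 / (1 + t powr p)) has_integral I) {0..1}"
    unfolding I_def using continuous_on_integrand[OF p]
    by (intro integrable_integral integrable_continuous_real)
  have pw: "((\<lambda>t. t powr c) has_integral 1 / (c + 1)) {0..1}" if "0 \<le> c" for c :: real
    using has_integral_powr_from_0[of c 1] that by simp
  have telescope: "(\<Sum>n<N. t powr (2 * real n * p) - t powr ((2 * real n + 1) * p))
      = (1 - t powr (2 * real N * p)) / (1 + t powr p)" if "0 < t" for t :: real and N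
  proof -
    have "0 < 1 + t powr p" using that by (simp add: add_pos_pos)
    moreover have "t powr (p * 2) = t powr p * t powr p"
      by (simp add: mult.commute flip: powr_add)
    ultimately show ?thesis using that
      by (induction N) (simp_all add: divide_simps, simp_all add: algebra_simps powr_add)
  qed
  have bound: "0 \<le> I - s N \<and> I - s N \<le> 1 / (2 * real N * p + 1)" for N
  proof -
    have "((\<lambda>t. \<Sum>n<N. t powr (2 * real n * p) - t powr ((2 * real n + 1) * p)) has_integral s N) {0..1}"
      unfolding s_def using p by (intro has_integral_sum has_integral_diff pw) auto
    \<comment> \<open>By the telescoped sum, the remainder has integrand
      \<open>t powr (2 * real N * p) / (1 + t powr p)\<close>. The point 0 is removed because the
      telescoping identity fails there: \<open>0 powr 0 = 0\<close>.\<close>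
    from has_integral_diff[OF int this]
    have R: "((\<lambda>t. t powr (2 * real N * p) / (1 + t powr p)) has_integral I - s N) {0..1}"
      by (rule has_integral_spike_finite[of "{0}", rotated 2])
         (auto simp: telescope diff_divide_distrib)
    have le: "t powr (2 * real N * p) / (1 + t powr p) \<le> t powr (2 * real N * p)" for t :: real
      using divide_left_mono[of 1 "1 + t powr p" "t powr (2 * real N * p)"] by (simp add: add_pos_nonneg)
    show ?thesis
      using has_integral_nonneg[OF R] has_integral_le[OF R pw[of "2 * real N * p"] le] p by auto
  qed
  have "(\<lambda>N. 1 / (2 * real N * p + 1)) \<longlonglongrightarrow> 0"
    using p by real_asymp
  hence "(\<lambda>N. I - s N) \<longlonglongrightarrow> 0"
    by (rule tendsto_sandwich[rotated 3]) (use bound in auto)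
  hence "(\<lambda>N. I - (I - s N)) \<longlonglongrightarrow> I - 0"
    by (intro tendsto_intros)
  hence "s \<longlonglongrightarrow> I" by simp
  moreover have "s \<longlonglongrightarrow> b p"
    using b_sums[OF p] by (simp add: sums_def s_def[abs_def])
  ultimately show ?thesis unfolding I_def by (rule LIMSEQ_unique[symmetric])
qed

lemma b_strict_mono:
  assumes "0 < p" "p < q"
  shows "b p < b q"
  using assms integrand_strict_mono
  by (auto simp: b_eq_integral intro!: integral_less_real continuous_on_integrand)

lemma b_pos:
  assumes "0 < p"
  shows "0 < b p"
proof -
  have "integral {0..1} (\<lambda>t::real. 0) < integral {0..1} (\<lambda>t. 1 / (1 + t powr p))"
    using assms by (intro integral_less_real continuous_on_integrand) (auto intro: add_pos_pos)
  thus ?thesis using assms by (simp add: b_eq_integral)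
qed

lemma b_strict_concave_aux:
  assumes a: "0 < a" "a < 1" and pq: "0 < p" "p < q"
  shows "a * b p + (1 - a) * b q < b (a * p + (1 - a) * q)"
proof -
  have m: "0 < a * p + (1 - a) * q" using assms by (simp add: add_pos_pos)
  note cont = continuous_on_integrand
  have "a * b p + (1 - a) * b q =
      integral {0..1} (\<lambda>t. a * (1 / (1 + t powr p)) + (1 - a) * (1 / (1 + t powr q)))"
    using pq cont[of p] cont[of q]
    by (subst integral_add)
       (auto simp: b_eq_integral simp del: times_divide_eq_right
             intro!: integrable_continuous_real continuous_on_mult_left)
  also have "\<dots> < integral {0..1} (\<lambda>t. 1 / (1 + t powr (a * p + (1 - a) * q)))"
    using a pq m integrand_strict_concave
    \<comment> \<open>Both integrands agree at \<open>t = 0\<close> and \<open>t = 1\<close>; by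
      continuity, strictness on the open interval suffices.\<close>
    by (intro integral_less_real continuous_on_add continuous_on_mult_left cont) auto
  also have "\<dots> = b (a * p + (1 - a) * q)" using m by (simp add: b_eq_integral)
  finally show ?thesis .
qed

text \<open>The claim is symmetric under exchanging \<open>p\<close> with \<open>q\<close> and
  \<open>a\<close> with \<open>1 - a\<close>, so the ordered case suffices.\<close>

lemma b_strict_concave:
  assumes a: "0 < a" "a < 1" and pq: "0 < p" "0 < q" "p \<noteq> q"
  shows "a * b p + (1 - a) * b q < b (a * p + (1 - a) * q)"
proof (cases "p < q")
  case False
  thus ?thesis using b_strict_concave_aux[of "1 - a" q p] assms by (simp add: add.commute)
qed (use b_strict_concave_aux assms in auto)

lemma b_am_gm:
  assumes a: "0 < a" "a < 1" and pq: "0 < p" "0 < q" "p \<noteq> q"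
  shows "b p powr a * b q powr (1 - a) < a * b p + (1 - a) * b q"
proof (cases "p < q")
  case True
  thus ?thesis using weighted_am_gm_strict b_pos b_strict_mono assms by simp
next
  case False
  thus ?thesis using weighted_am_gm_strict[of "1 - a" "b q" "b p"] b_pos b_strict_mono assms
    by (simp add: add.commute mult.commute)
qed

theorem mainTheorem4:
  shows "concave_on {0<..} b \<and>
    (\<forall>\<alpha> p q :: real. 0 < \<alpha> \<and> \<alpha> < 1 \<and> 0 < p \<and> 0 < q \<and> p \<noteq> q \<longrightarrow>
       b (\<alpha> * p + (1 - \<alpha>) * q) > \<alpha> * b p + (1 - \<alpha>) * b q \<and>
       \<alpha> * b p + (1 - \<alpha>) * b q > b p powr \<alpha> * b q powr (1 - \<alpha>)) \<and>
    (\<forall>s::real. s > 1 \<longrightarrow> (b s)\<^sup>2 > b (s - 1) * b (s + 1))"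
proof (intro conjI allI impI)
  show "concave_on {0<..} b"
    unfolding concave_on_iff
  proof (intro conjI ballI allI impI)
    fix p q u v :: real
    assume pq: "p \<in> {0<..}" "q \<in> {0<..}" and uv: "0 \<le> u" "0 \<le> v" "u + v = 1"
    have v: "v = 1 - u" using uv by simp
    \<comment> \<open>The first three cases are the degenerate ones, where equality holds; the last
      is strict concavity.\<close>
    consider "u = 0" | "u = 1" | "p = q" | "0 < u" "u < 1" "p \<noteq> q" using uv by linarith
    thus "u * b p + v * b q \<le> b (u *\<^sub>R p + v *\<^sub>R q)"
      by cases (use pq b_strict_concave[of u p q] in \<open>auto simp: v algebra_simps\<close>)
  qed simp
next
  fix s :: real assume s: "s > 1"
  \<comment> \<open>\<open>s\<close> is the midpoint of \<open>s - 1\<close> and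
    \<open>s + 1\<close>, and \<open>s > 1\<close> keeps \<open>s - 1\<close> positive.\<close>
  have "(b (s - 1) + b (s + 1)) / 2 < b s"
    using b_strict_concave[of "1/2" "s - 1" "s + 1"] s by (simp add: field_simps)
  moreover have "0 < b (s - 1)" "0 < b (s + 1)" using s by (auto intro: b_pos)
  ultimately have "((b (s - 1) + b (s + 1)) / 2)\<^sup>2 < (b s)\<^sup>2"
    by (intro power_strict_mono) auto
  \<comment> \<open>The two sides differ by a quarter of the square of
    \<open>b (s - 1) - b (s + 1)\<close>.\<close>
  moreover have "b (s - 1) * b (s + 1) \<le> ((b (s - 1) + b (s + 1)) / 2)\<^sup>2"
    using zero_le_power2[of "b (s - 1) - b (s + 1)"] by (simp add: power2_eq_square field_simps)
  ultimately show "b (s - 1) * b (s + 1) < (b s)\<^sup>2" by linarith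
qed (use b_strict_concave b_am_gm in auto)

end
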